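(* Let $n\ge 1$ and let $\mathbf m=(m_1,\dots,m_{n+1})\in\mathbb Z^{n+1}$, $\mathbf k=(k_1,\dots,k_n)\in\mathbb Z^n$ satisfy $m_1\ge k_1\ge m_2\ge k_2\ge\cdots\ge m_n\ge k_n\ge m_{n+1}$. Perform the complete urn experiment associated with $(\mathbf m,\mathbf k)$ described in the context, which produces a random word $w\in S_{n+1}$. Then for every $1\le j\le n+1$, the probability that $w\in S_{j,n+1}$ is $$a_j^2(\mathbf m,\mathbf k)=\left\vert\frac{\prod_{i=1}^{n}(k_i-m_j-i+j-1)}{\prod_{1\le i\le n+1,\ i\ne j}(m_i-m_j-i+j)}\right\vert .$$
   Context: Urns. Take $n$ urns $B_1,\dots,B_n$. Urn $B_j$ contains $m_j-k_j+1$ balls of color $c_j$ and $k_j-m_{j+1}$ balls of color $d_j$; the $2n$ colors $c_1,d_1,\dots,c_n,d_n$ are pairwise distinct. For $1\le k\le j\le n$ let $B_{k,j}=B_k\cup B_{k+1}\cup\cdots\cup B_j$ be the urn whose content is the union of all balls in $B_k,\dots,B_j$. Order the index pairs by: $(k,j)<(r,s)$ if $j<s$, or if $j=s$ and $r<k$. So the order is $B_{1,1},B_{2,2},B_{1,2},B_{3,3},B_{2,3},B_{1,3},\dots,B_{n,n},B_{n-1,n},\dots,B_{1,n}$. Complete experiment. Going through the $n(n+1)/2$ urns $B_{k,j}$ in this order, draw from each one ball uniformly at random (draws are independent, each ball is put back after being drawn), and record its color. The recorded colors form a word of $n(n+1)/2$ letters; the letter coming from $B_{k,j}$ is said to be in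 the $(k,j)$-place. Sample space. $S_{n+1}$ is the set of all words of $n(n+1)/2$ letters, with places indexed by the pairs $(k,j)$, $1\le k\le j\le n$, arranged in the order $(1,1),(2,2),(1,2),(3,3),(2,3),(1,3),\dots,(n,n),(n-1,n),\dots,(1,n)$, whose letter in the $(k,j)$-place belongs to $\{c_p,d_p: k\le p\le j\}$. (Words using a color with no balls have probability $0$.) Thus $S_n$ consists of words of $n(n-1)/2$ letters, and a word of $S_{n+1}$ is a word of $S_n$ followed by $n$ letters, in the places $(n,n),(n-1,n),\dots,(1,n)$. The subsets $S_{j,n+1}$ are defined inductively. $S_{1,2}=\{c_1\}$ and $S_{2,2}=\{d_1\}$. For $n\ge2$ and $1\le j\le n$, $S_{j,n+1}$ is the set of words in $S_{n+1}$ whose initial subword of $n(n-1)/2$ letters belongs to $S_{j,n}$ and whose letter in the $(j,n)$-place is different from $d_n$ (the other $n-1$ of the last $n$ letters are arbitrary). Finally, $S_{n+1,n+1}$ is the union over $1\le j\le n$ of the sets of words in $S_{n+1}$ whose initial subword of $n(n-1)/2$ letters belongs to $S_{j,n}$ and whose letter in the $(j,n)$-place equals $d_n$. *)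

theory Defs
  imports "HOL-Probability.Probability"
begin

datatype color = ColC nat | ColD nat

text \<open>All families (\<open>m\<close>, \<open>k\<close>, urns, colors) are indexed from 1; the values of \<open>m\<close> outside
  \<open>{1..n+1}\<close> and of \<open>k\<close> outside \<open>{1..n}\<close> are never used. Under the interlacing condition
  both arguments of \<open>nat\<close> are nonnegative and the first one is positive.\<close>

definition urn :: "(nat \<Rightarrow> int) \<Rightarrow> (nat \<Rightarrow> int) \<Rightarrow> nat \<Rightarrow> color multiset" where
  "urn m k j = replicate_mset (nat (m j - k j + 1)) (ColC j)
             + replicate_mset (nat (k j - m (j + 1))) (ColD j)"

definition urn_union :: "(nat \<Rightarrow> int) \<Rightarrow> (nat \<Rightarrow> int) \<Rightarrow> nat \<times> nat \<Rightarrow> color multiset" where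
  "urn_union m k = (\<lambda>(r, j). \<Sum>i = r..j. urn m k i)"

definition place_less :: "nat \<times> nat \<Rightarrow> nat \<times> nat \<Rightarrow> bool" where
  "place_less = (\<lambda>(k, j) (r, s). j < s \<or> j = s \<and> r < k)"

definition places :: "nat \<Rightarrow> (nat \<times> nat) list" where
  "places n = concat (map (\<lambda>j. map (\<lambda>r. (r, j)) (rev [1..<j + 1])) [1..<n + 1])"

definition place_index :: "nat \<times> nat \<Rightarrow> nat" where
  "place_index = (\<lambda>(r, j). j * (j - 1) div 2 + (j - r))"

definition letter :: "color list \<Rightarrow> nat \<times> nat \<Rightarrow> color" where
  "letter w p = w ! place_index p"

lemma places_0: "places 0 = []"
  by (simp add: places_def)

lemma places_Suc: "places (Suc n) = places n @ map (\<lambda>r. (r, Suc n)) (rev [1..<Suc n + 1])"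
  by (simp add: places_def)

lemma triangle_Suc: "Suc n * (Suc n + 1) div 2 = n * (n + 1) div 2 + Suc n"
  by (induction n) auto

lemma length_places: "length (places n) = n * (n + 1) div 2"
proof (induction n)
  case (Suc n)
  then show ?case
    unfolding places_Suc triangle_Suc by simp
qed (simp add: places_0)

lemma set_places: "set (places n) = {(r, j). 1 \<le> r \<and> r \<le> j \<and> j \<le> n}"
  by (auto simp: places_def image_iff)

lemma sorted_places: "sorted_wrt place_less (places n)"
proof (induction n)
  case (Suc n)
  have "sorted_wrt (\<lambda>r s. place_less (r, Suc n) (s, Suc n)) (rev [1..<Suc n + 1])"
    unfolding sorted_wrt_rev place_less_def by (simp del: upt_Suc)
  then show ?case
    unfolding places_Suc sorted_wrt_append sorted_wrt_map using Suc
    by (force simp: set_places place_less_def)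
qed (simp add: places_0)

lemma places_nth:
  assumes "1 \<le> r" "r \<le> j" "j \<le> n"
  shows "place_index (r, j) < length (places n)" "places n ! place_index (r, j) = (r, j)"
proof -
  have "place_index (r, j) < length (places n) \<and> places n ! place_index (r, j) = (r, j)"
    using assms(3)
  proof (induction n rule: dec_induct)
    case base
    obtain i where i: "j = Suc i" using assms by (cases j) auto
    have idx: "place_index (r, Suc i) = length (places i) + (Suc i - r)"
      by (simp add: place_index_def length_places mult.commute)
    show ?case
      unfolding i idx places_Suc
      using assms i by (auto simp: nth_append rev_nth simp del: upt_Suc)
  next
    case (step n)
    then show ?case by (simp add: places_Suc nth_append del: upt_Suc)
  qed
  then show "place_index (r, j) < length (places n)" "places n ! place_index (r, j) = (r, j)"
    by auto
qed

text \<open>Independent uniform draws, one from each urn of the list, recorded in order.\<close>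

fun draw_word :: "color multiset list \<Rightarrow> color list pmf" where
  "draw_word [] = return_pmf []"
| "draw_word (U # Us) =
     bind_pmf (pmf_of_multiset U) (\<lambda>c. map_pmf (\<lambda>w. c # w) (draw_word Us))"

definition complete_experiment :: "nat \<Rightarrow> (nat \<Rightarrow> int) \<Rightarrow> (nat \<Rightarrow> int) \<Rightarrow> color list pmf" where
  "complete_experiment n m k = draw_word (map (urn_union m k) (places n))"

text \<open>\<open>word_space N\<close> is the sample space \<open>S\<^sub>N\<close>; its words come from the experiment with \<open>N - 1\<close> basic urns.\<close>

definition word_space :: "nat \<Rightarrow> color list set" where
  "word_space N = {w. length w = N * (N - 1) div 2 \<and>
             (\<forall>r j. 1 \<le> r \<and> r \<le> j \<and> j < N \<longrightarrow>
                letter w (r, j) \<in> ColC ` {r..j} \<union> ColD ` {r..j})}"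

text \<open>\<open>S_sub j N\<close> is \<open>S\<^bsub>j,N\<^esub>\<close>, defined for \<open>N \<ge> 2\<close> and \<open>1 \<le> j \<le> N\<close>, and empty by convention
  otherwise.\<close>

fun S_sub :: "nat \<Rightarrow> nat \<Rightarrow> color list set" where
  "S_sub j 0 = {}"
| "S_sub j (Suc n) =
     (if n = 0 then {}
      else if n = 1 then
        (if j = 1 then {[ColC 1]} else if j = 2 then {[ColD 1]} else {})
      else if 1 \<le> j \<and> j \<le> n then
        {w \<in> word_space (n + 1). take (n * (n - 1) div 2) w \<in> S_sub j n
              \<and> letter w (j, n) \<noteq> ColD n}
      else if j = n + 1 then
        (\<Union>i\<in>{1..n}.
          {w \<in> word_space (n + 1). take (n * (n - 1) div 2) w \<in> S_sub i n
              \<and> letter w (i, n) = ColD n})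
      else {})"

end

theory Submission
  imports Defs
begin

text \<open>
  Put \<open>x\<^sub>i = m\<^sub>i - i\<close> and \<open>y\<^sub>i = k\<^sub>i - i - 1\<close>. Interlacing becomes
  \<open>x\<^sub>1 > y\<^sub>1 \<ge> x\<^sub>2 > y\<^sub>2 \<ge> \<dots> \<ge> x\<^bsub>n+1\<^esub>\<close>, the urn \<open>B\<^bsub>r,n\<^esub>\<close> holds \<open>x\<^sub>r - x\<^bsub>n+1\<^esub>\<close>
  balls, of which \<open>y\<^sub>n - x\<^bsub>n+1\<^esub>\<close> have color \<open>d\<^sub>n\<close>, and the claimed probability is the weight
  \<open>\<Prod>\<^sub>i (x\<^sub>j - y\<^sub>i) / \<Prod>\<^bsub>i\<noteq>j\<^esub> (x\<^sub>j - x\<^sub>i)\<close>, up to a sign that is fixed because a probability is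
  nonnegative. The last row of letters is independent of the earlier ones. Not drawing \<open>d\<^sub>n\<close> in the
  \<open>(j, n)\<close>-place has probability \<open>(x\<^sub>j - y\<^sub>n) / (x\<^sub>j - x\<^bsub>n+1\<^esub>)\<close>, which is exactly the factor
  between consecutive weights when \<open>j \<le> n\<close>. For \<open>j = n + 1\<close> the contributions of all earlier indices
  add up, and the sum is the partial fraction expansion of
  \<open>\<Prod>\<^bsub>i<n\<^esub> (z - y\<^sub>i) / \<Prod>\<^bsub>i\<le>n\<^esub> (z - x\<^sub>i)\<close> evaluated at \<open>z = x\<^bsub>n+1\<^esub>\<close>.
\<close>

section \<open>Partial fractions\<close>

text \<open>For distinct \<open>x i\<close>, this is the residue at \<open>x j\<close> of the
  rational function with numerator factors \<open>z - y i\<close> and denominator factors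
  \<open>z - x i\<close>.\<close>

definition lagrange_weight :: "(nat \<Rightarrow> 'a::field) \<Rightarrow> (nat \<Rightarrow> 'a) \<Rightarrow> nat \<Rightarrow> nat \<Rightarrow> 'a" where
  "lagrange_weight x y n j =
     (\<Prod>i = 1..n. x j - y i) / (\<Prod>i\<in>{1..n + 1} - {j}. x j - x i)"

lemma lagrange_weight_Suc:
  assumes "j \<in> {1..n + 1}"
  shows "lagrange_weight x y (Suc n) j =
    lagrange_weight x y n j * ((x j - y (Suc n)) / (x j - x (n + 2)))"
proof -
  have "{1..Suc n + 1} - {j} = insert (n + 2) ({1..n + 1} - {j})"
    using assms by auto
  then show ?thesis
    by (simp add: lagrange_weight_def mult.commute)
qed

lemma lagrange_weight_last:
  "lagrange_weight x y (Suc n) (n + 2) =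
    (x (n + 2) - y (Suc n)) * ((\<Prod>i = 1..n. x (n + 2) - y i) / (\<Prod>i = 1..n + 1. x (n + 2) - x i))"
proof -
  have "{1..Suc n + 1} - {n + 2} = {1..n + 1}"
    by auto
  then show ?thesis
    by (simp add: lagrange_weight_def mult.commute)
qed

text \<open>Passing from \<open>n\<close> to \<open>Suc n\<close> adds one zero \<open>b\<close> and
  one pole \<open>u\<close>. The point \<open>z\<close> is generalized because the induction
  hypothesis is used at \<open>z\<close> and also at the new pole \<open>u\<close>.\<close>

lemma partial_fractions:
  fixes x y :: "nat \<Rightarrow> 'a::field"
  assumes "inj_on x {1..n + 1}" and "\<And>i. i \<in> {1..n + 1} \<Longrightarrow> z \<noteq> x i"
  shows "(\<Sum>j = 1..n + 1. lagrange_weight x y n j / (z - x j)) =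
    (\<Prod>i = 1..n. z - y i) / (\<Prod>i = 1..n + 1. z - x i)"
  using assms
proof (induction n arbitrary: z)
  case 0
  then show ?case by (simp add: lagrange_weight_def)
next
  case (Suc n)
  let ?W = "lagrange_weight x y"
  define F where "F z = (\<Prod>i = 1..n. z - y i) / (\<Prod>i = 1..n + 1. z - x i)" for z
  define u b where "u = x (n + 2)" and "b = y (Suc n)"
  have inj: "inj_on x {1..n + 1}"
    using Suc.prems(1) by (rule inj_on_subset) auto
  have u: "u \<noteq> x i" if "i \<in> {1..n + 1}" for i
    using inj_onD[OF Suc.prems(1), of "n + 2" i] that by (auto simp: u_def)
  have zu: "z \<noteq> u"
    using Suc.prems(2)[of "n + 2"] by (simp add: u_def)
  have IHz: "(\<Sum>j = 1..n + 1. ?W n j / (z - x j)) = F z"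
    unfolding F_def using Suc.prems(2) by (intro Suc.IH inj) auto
  have IHu: "(\<Sum>j = 1..n + 1. ?W n j / (u - x j)) = F u"
    unfolding F_def using u by (intro Suc.IH inj) auto
  \<comment> \<open>As a function of \<open>x j\<close>, the quotient
    \<open>(x j - b) / ((x j - u) * (z - x j))\<close> splits into two fractions with poles at
    \<open>z\<close> and \<open>u\<close>. Summed over \<open>j\<close>, they give multiples of
    \<open>F z\<close> and \<open>F u\<close>.\<close>
  have "?W (Suc n) j / (z - x j) =
      (z - b) / (z - u) * (?W n j / (z - x j)) - (u - b) / (z - u) * (?W n j / (u - x j))"
    if j: "j \<in> {1..n + 1}" for j
  proof -
    have ne: "z - u \<noteq> 0" "z - x j \<noteq> 0" "u - x j \<noteq> 0" "x j - u \<noteq> 0"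
      using zu Suc.prems(2)[of j] u[OF j] j by auto
    have "(x j - b) / (x j - u) / (z - x j) =
        (z - b) / (z - u) / (z - x j) - (u - b) / (z - u) / (u - x j)"
      using ne by (simp add: divide_simps) (simp add: algebra_simps)
    from arg_cong[OF this, of "(*) (?W n j)"] show ?thesis
      by (simp add: lagrange_weight_Suc[OF j] u_def b_def right_diff_distrib mult_ac)
  qed
  then have "(\<Sum>j = 1..n + 1. ?W (Suc n) j / (z - x j)) =
      (\<Sum>j = 1..n + 1. (z - b) / (z - u) * (?W n j / (z - x j)) - (u - b) / (z - u) * (?W n j / (u - x j)))"
    by (intro sum.cong refl)
  also have "\<dots> = (z - b) / (z - u) * F z - (u - b) / (z - u) * F u"
    by (simp only: sum_subtractf sum_distrib_left[symmetric] IHz IHu)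
  \<comment> \<open>The term for \<open>j = n + 2\<close> is \<open>(u - b) / (z - u) * F u\<close>,
    which cancels the subtracted one.\<close>
  finally have "(\<Sum>j = 1..Suc n + 1. ?W (Suc n) j / (z - x j)) = (z - b) / (z - u) * F z"
    using lagrange_weight_last[of x y n]
    by (simp add: u_def b_def F_def)
  then show ?case
    by (simp add: F_def u_def b_def mult.commute)
qed

section \<open>Independent draws\<close>

lemma prob_pair_Times:
  "measure_pmf.prob (pair_pmf M N) (A \<times> B) = measure_pmf.prob M A * measure_pmf.prob N B"
proof -
  \<comment> \<open>The product rule is applied to countable sets, so both events are first cut down
    to the supports.\<close>
  have "measure_pmf.prob (pair_pmf M N) (A \<times> B) =
      measure_pmf.prob (pair_pmf M N) ((A \<inter> set_pmf M) \<times> (B \<inter> set_pmf N))"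
    by (subst measure_Int_set_pmf[symmetric]) (rule arg_cong[where f = "measure _"], auto)
  also have "\<dots> = measure_pmf.prob M (A \<inter> set_pmf M) * measure_pmf.prob N (B \<inter> set_pmf N)"
    by (rule measure_pmf_prob_product) (auto intro: countable_subset[OF _ countable_set_pmf])
  finally show ?thesis
    by (simp add: measure_Int_set_pmf)
qed

lemma draw_word_append:
  "draw_word (Us @ Vs) = map_pmf (\<lambda>(u, v). u @ v) (pair_pmf (draw_word Us) (draw_word Vs))"
proof (induction Us)
  case Nil
  then show ?case
    by (simp add: pair_return_pmf1 pmf.map_comp o_def)
next
  case (Cons U Us)
  then show ?case
    by (simp add: pair_pmf_def map_pmf_def bind_assoc_pmf bind_return_pmf)
qed

lemma map_nth_draw_word:
  "i < length Us \<Longrightarrow> map_pmf (\<lambda>w. w ! i) (draw_word Us) = pmf_of_multiset (Us ! i)"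
proof (induction Us arbitrary: i)
  case (Cons U Us)
  show ?case
  proof (cases i)
    case 0
    then show ?thesis
      by (simp add: map_bind_pmf pmf.map_comp o_def bind_return_pmf')
  next
    case (Suc l)
    then show ?thesis
      using Cons by (simp add: map_bind_pmf pmf.map_comp o_def)
  qed
qed simp

lemma draw_word_support:
  assumes "\<forall>U\<in>set Us. U \<noteq> {#}" and "w \<in> set_pmf (draw_word Us)"
  shows "list_all2 (\<in>#) w Us"
  using assms by (induction Us arbitrary: w) auto

lemma prob_pmf_of_multiset_singleton:
  assumes "U \<noteq> {#}"
  shows "measure_pmf.prob (pmf_of_multiset U) {c} = count U c / size U"
  using assms by (simp add: measure_pmf_single)

section \<open>The complete experiment\<close>

text \<open>Because the range is reversed, the letter from the urn \<open>(r, n)\<close> stands at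
  position \<open>n - r\<close> of the row.\<close>

definition row_draws :: "(nat \<Rightarrow> int) \<Rightarrow> (nat \<Rightarrow> int) \<Rightarrow> nat \<Rightarrow> color list pmf" where
  "row_draws m k n = draw_word (map (\<lambda>r. urn_union m k (r, n)) (rev [1..<n + 1]))"

lemma complete_experiment_Suc:
  "complete_experiment (Suc n) m k =
    map_pmf (\<lambda>(u, v). u @ v) (pair_pmf (complete_experiment n m k) (row_draws m k (Suc n)))"
  by (simp add: complete_experiment_def row_draws_def places_Suc draw_word_append o_def del: upt_Suc)

section \<open>Urn contents in the shifted coordinates\<close>

locale interlacing =
  fixes n :: nat and m k :: "nat \<Rightarrow> int"
  assumes interlacing: "\<And>i. i \<in> {1..n} \<Longrightarrow> k i \<le> m i \<and> m (i + 1) \<le> k i"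
begin

abbreviation x :: "nat \<Rightarrow> real" where "x i \<equiv> real_of_int (m i - int i)"

abbreviation y :: "nat \<Rightarrow> real" where "y i \<equiv> real_of_int (k i - int i - 1)"

lemma m_antimono:
  assumes "1 \<le> i" "i \<le> j" "j \<le> n + 1"
  shows "m j \<le> m i"
  using assms(2,3)
proof (induction j rule: dec_induct)
  case (step l)
  then show ?case
    using interlacing[of l] assms(1) by simp
qed simp

text \<open>The shift by \<open>i\<close> makes the weak inequalities strict even where values of
  \<open>m\<close> coincide. This keeps urns nonempty and denominators nonzero.\<close>

lemma x_strict_antimono:
  assumes "1 \<le> i" "i < j" "j \<le> n + 1"
  shows "x j < x i"
  using m_antimono[of i j] assms by simp

lemma inj_on_x: "inj_on x {1..n + 1}"
  by (rule inj_onI) (metis atLeastAtMost_iff less_irrefl nat_neq_iff x_strict_antimono)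

lemma size_urn:
  assumes "i \<in> {1..n}"
  shows "real (size (urn m k i)) = x i - x (i + 1)"
  using interlacing[OF assms] by (simp add: urn_def)

lemma size_urn_union:
  assumes "1 \<le> r" "r \<le> j" "j \<le> n"
  shows "real (size (urn_union m k (r, j))) = x r - x (j + 1)"
proof -
  have "real (size (urn_union m k (r, j))) = (\<Sum>i = r..j. real (size (urn m k i)))"
    by (simp add: urn_union_def size_multiset_sum)
  also have "\<dots> = (\<Sum>i = r..j. x i - x (Suc i))"
    using assms size_urn by (intro sum.cong) auto
  also have "\<dots> = x r - x (Suc j)"
    \<comment> \<open>The sizes of the basic urns telescope; the sign change matches the direction
      of the differences.\<close>
    using sum_Suc_diff[of r j "\<lambda>i. - x i"] assms by (simp add: algebra_simps)
  finally show ?thesis by simp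
qed

lemma urn_union_nonempty:
  assumes "1 \<le> r" "r \<le> j" "j \<le> n"
  shows "urn_union m k (r, j) \<noteq> {#}"
proof
  assume "urn_union m k (r, j) = {#}"
  then show False
    using size_urn_union[OF assms] x_strict_antimono[of r "j + 1"] assms by simp
qed

lemma count_urn_union_ColD:
  assumes "1 \<le> r" "r \<le> n"
  shows "real (count (urn_union m k (r, n)) (ColD n)) = y n - x (n + 1)"
proof -
  have "count (urn_union m k (r, n)) (ColD n) = (\<Sum>i = r..n. count (urn m k i) (ColD n))"
    by (simp add: urn_union_def count_sum)
  \<comment> \<open>Only the last basic urn holds color \<open>ColD n\<close>, so the count does not
    depend on \<open>r\<close>.\<close>
  also have "\<dots> = (\<Sum>i = r..n. if i = n then nat (k n - m (n + 1)) else 0)"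
    by (intro sum.cong) (auto simp: urn_def)
  also have "\<dots> = nat (k n - m (n + 1))"
    using assms by simp
  finally show ?thesis
    using interlacing[of n] assms by simp
qed

lemma set_urn_union: "set_mset (urn_union m k (r, j)) \<subseteq> ColC ` {r..j} \<union> ColD ` {r..j}"
  by (auto simp: urn_union_def urn_def set_mset_sum split: if_splits)

text \<open>This discharges the \<open>word_space\<close> conditions in \<open>S_sub\<close>: for
  drawn words only the prefix and one letter of the last row decide membership.\<close>

lemma complete_experiment_support: "set_pmf (complete_experiment n m k) \<subseteq> word_space (n + 1)"
proof
  fix w assume "w \<in> set_pmf (complete_experiment n m k)"
  then have w: "list_all2 (\<in>#) w (map (urn_union m k) (places n))"
    unfolding complete_experiment_def
    by (intro draw_word_support) (auto simp: set_places urn_union_nonempty)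
  have "letter w (r, j) \<in> ColC ` {r..j} \<union> ColD ` {r..j}" if "1 \<le> r" "r \<le> j" "j \<le> n" for r j
  proof -
    have "w ! place_index (r, j) \<in># urn_union m k (r, j)"
      using list_all2_nthD2[OF w, of "place_index (r, j)"] places_nth[OF that] by simp
    then show ?thesis
      using set_urn_union unfolding letter_def by blast
  qed
  moreover have "length w = n * (n + 1) div 2"
    using list_all2_lengthD[OF w] by (simp add: length_places)
  ultimately show "w \<in> word_space (n + 1)"
    by (simp add: word_space_def mult.commute)
qed

lemma prob_row_ColD:
  assumes "r \<in> {1..n}"
  shows "measure_pmf.prob (row_draws m k n) {v. v ! (n - r) = ColD n} = (y n - x (n + 1)) / (x r - x (n + 1))"
proof -
  have "map_pmf (\<lambda>v. v ! (n - r)) (row_draws m k n) = pmf_of_multiset (urn_union m k (r, n))"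
    unfolding row_draws_def using assms
    by (subst map_nth_draw_word) (auto simp: rev_nth simp del: upt_Suc)
  then have "measure_pmf.prob (row_draws m k n) ((\<lambda>v. v ! (n - r)) -` {ColD n}) =
      measure_pmf.prob (pmf_of_multiset (urn_union m k (r, n))) {ColD n}"
    by (metis measure_map_pmf)
  also have "\<dots> = (y n - x (n + 1)) / (x r - x (n + 1))"
  proof -
    have r: "1 \<le> r" "r \<le> n"
      using assms by auto
    show ?thesis
      unfolding prob_pmf_of_multiset_singleton[OF urn_union_nonempty[OF r order_refl]]
        size_urn_union[OF r order_refl] count_urn_union_ColD[OF r] ..
  qed
  finally show ?thesis by (simp add: vimage_def)
qed

lemma prob_row_not_ColD:
  assumes "r \<in> {1..n}"
  shows "measure_pmf.prob (row_draws m k n) {v. v ! (n - r) \<noteq> ColD n} = (x r - y n) / (x r - x (n + 1))"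
proof -
  have "measure_pmf.prob (row_draws m k n) {v. v ! (n - r) \<noteq> ColD n} =
      1 - (y n - x (n + 1)) / (x r - x (n + 1))"
    using measure_pmf.prob_compl[of "{v. v ! (n - r) = ColD n}" "row_draws m k n"] prob_row_ColD[OF assms]
    by (simp add: Compl_eq_Diff_UNIV[symmetric] Collect_neg_eq)
  moreover have "x r \<noteq> x (n + 1)"
    using x_strict_antimono[of r "n + 1"] assms by simp
  ultimately show ?thesis
    by (simp add: diff_divide_distrib[symmetric] field_simps)
qed

end

section \<open>The index of a word as a state updated row by row\<close>

declare S_sub.simps [simp del]

text \<open>Both cases of the recursion become one deterministic transition: index \<open>i\<close>
  jumps to \<open>n + 2\<close> if its letter is \<open>ColD (n + 1)\<close>, and stays
  otherwise.\<close>

lemma S_sub_add_2: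
  assumes "n \<ge> 1"
  shows "w \<in> S_sub j (n + 2) \<longleftrightarrow> w \<in> word_space (n + 2) \<and>
    (\<exists>i\<in>{1..n + 1}. take ((n + 1) * n div 2) w \<in> S_sub i (n + 1) \<and>
       j = (if letter w (i, n + 1) = ColD (n + 1) then n + 2 else i))"
proof -
  have "Suc (n + 1) = n + 2" "n + 1 + 1 = n + 2" "n + 1 - 1 = n" "n + 1 \<noteq> 0" "n + 1 \<noteq> 1"
    using assms by simp_all
  then have S: "S_sub j (n + 2) =
      (if 1 \<le> j \<and> j \<le> n + 1 then
        {w \<in> word_space (n + 2). take ((n + 1) * n div 2) w \<in> S_sub j (n + 1)
              \<and> letter w (j, n + 1) \<noteq> ColD (n + 1)}
      else if j = n + 2 then
        (\<Union>i\<in>{1..n + 1}.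
          {w \<in> word_space (n + 2). take ((n + 1) * n div 2) w \<in> S_sub i (n + 1)
              \<and> letter w (i, n + 1) = ColD (n + 1)})
      else {})"
    using S_sub.simps(2)[of j "n + 1"] by (simp only: if_False)
  have ex: "(\<exists>i\<in>{1..n + 1}. A i \<and> j = (if B i then n + 2 else i)) \<longleftrightarrow>
      (if 1 \<le> j \<and> j \<le> n + 1 then A j \<and> \<not> B j
       else if j = n + 2 then \<exists>i\<in>{1..n + 1}. A i \<and> B i else False)" for A B
    by (cases "j = n + 2") (auto split: if_splits)
  show ?thesis
    unfolding S ex by simp
qed

text \<open>The prefix has at most one index by induction, and the transition determines the next
  one from it and the word.\<close>

lemma S_sub_disjoint: "w \<in> S_sub i N \<Longrightarrow> w \<in> S_sub j N \<Longrightarrow> i = j"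
proof (induction N arbitrary: i j w)
  case (Suc N)
  consider "N = 0" | "N = 1" | n where "n \<ge> 1" "N = n + 1"
    by (metis One_nat_def Suc_eq_plus1 less_one not_less old.nat.exhaust)
  then show ?case
  proof cases
    case 3
    then have N: "Suc N = n + 2" by simp
    obtain r where r: "take ((n + 1) * n div 2) w \<in> S_sub r (n + 1)"
        "i = (if letter w (r, n + 1) = ColD (n + 1) then n + 2 else r)"
      using Suc.prems(1) unfolding N S_sub_add_2[OF 3(1)] by (elim conjE bexE)
    obtain s where s: "take ((n + 1) * n div 2) w \<in> S_sub s (n + 1)"
        "j = (if letter w (s, n + 1) = ColD (n + 1) then n + 2 else s)"
      using Suc.prems(2) unfolding N S_sub_add_2[OF 3(1)] by (elim conjE bexE)
    have "r = s"
      using r(1) s(1) unfolding 3(2)[symmetric] by (rule Suc.IH)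
    then show ?thesis
      using r(2) s(2) by simp
  qed (use Suc.prems in \<open>auto simp: S_sub.simps split: if_splits\<close>)
qed (simp add: S_sub.simps)

lemma append_in_S_sub:
  assumes "n \<ge> 1" and "u \<in> word_space (n + 1)" and "u @ v \<in> word_space (n + 2)"
  shows "j \<in> {1..n + 1} \<Longrightarrow> u @ v \<in> S_sub j (n + 2) \<longleftrightarrow>
           u \<in> S_sub j (n + 1) \<and> v ! (n + 1 - j) \<noteq> ColD (n + 1)"
    and "u @ v \<in> S_sub (n + 2) (n + 2) \<longleftrightarrow>
           (\<exists>i\<in>{1..n + 1}. u \<in> S_sub i (n + 1) \<and> v ! (n + 1 - i) = ColD (n + 1))"
proof -
  have len: "length u = (n + 1) * n div 2"
    using assms(2) by (simp add: word_space_def)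
  have letter: "letter (u @ v) (i, n + 1) = v ! (n + 1 - i)" for i
    by (simp add: letter_def place_index_def len nth_append)
  have take: "take ((n + 1) * n div 2) (u @ v) = u"
    using len by simp
  note S = S_sub_add_2[OF assms(1), of "u @ v", unfolded take letter]
  show "j \<in> {1..n + 1} \<Longrightarrow> u @ v \<in> S_sub j (n + 2) \<longleftrightarrow>
           u \<in> S_sub j (n + 1) \<and> v ! (n + 1 - j) \<noteq> ColD (n + 1)"
    unfolding S using assms(3) by (auto simp del: One_nat_def)
  show "u @ v \<in> S_sub (n + 2) (n + 2) \<longleftrightarrow>
           (\<exists>i\<in>{1..n + 1}. u \<in> S_sub i (n + 1) \<and> v ! (n + 1 - i) = ColD (n + 1))"
    unfolding S using assms(3) by (auto simp del: One_nat_def)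
qed

section \<open>Probabilities of the index sets\<close>

lemma prob_complete_experiment_Suc:
  assumes n: "n \<ge> 1" and "interlacing (Suc n) m k"
  defines "E \<equiv> complete_experiment n m k" and "R \<equiv> row_draws m k (Suc n)"
  shows "j \<in> {1..n + 1} \<Longrightarrow>
      measure_pmf.prob (complete_experiment (Suc n) m k) (S_sub j (n + 2)) =
      measure_pmf.prob E (S_sub j (n + 1)) * measure_pmf.prob R {v. v ! (n + 1 - j) \<noteq> ColD (n + 1)}"
    and "measure_pmf.prob (complete_experiment (Suc n) m k) (S_sub (n + 2) (n + 2)) =
      (\<Sum>i = 1..n + 1. measure_pmf.prob E (S_sub i (n + 1)) *
                        measure_pmf.prob R {v. v ! (n + 1 - i) = ColD (n + 1)})"
proof -
  interpret interlacing "Suc n" m k by fact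
  interpret prev: interlacing n m k
    using interlacing by unfold_locales auto
  have support: "u \<in> word_space (n + 1)" "u @ v \<in> word_space (n + 2)"
    if "(u, v) \<in> set_pmf (pair_pmf E R)" for u v
    using that prev.complete_experiment_support complete_experiment_support
    by (auto simp: complete_experiment_Suc E_def R_def)
  \<comment> \<open>Events need to agree only on the support, where \<open>append_in_S_sub\<close>
    applies.\<close>
  have transport: "measure_pmf.prob (complete_experiment (Suc n) m k) A = measure_pmf.prob (pair_pmf E R) B"
    if "\<And>u v. (u, v) \<in> set_pmf (pair_pmf E R) \<Longrightarrow> u @ v \<in> A \<longleftrightarrow> (u, v) \<in> B" for A B
  proof -
    have "measure_pmf.prob (complete_experiment (Suc n) m k) A =
        measure_pmf.prob (pair_pmf E R) ((\<lambda>(u, v). u @ v) -` A)"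
      by (simp add: complete_experiment_Suc E_def R_def)
    also have "\<dots> = measure_pmf.prob (pair_pmf E R) B"
      by (rule measure_pmf.finite_measure_eq_AE) (use that in \<open>auto simp: AE_measure_pmf_iff\<close>)
    finally show ?thesis .
  qed
  show "measure_pmf.prob (complete_experiment (Suc n) m k) (S_sub j (n + 2)) =
      measure_pmf.prob E (S_sub j (n + 1)) * measure_pmf.prob R {v. v ! (n + 1 - j) \<noteq> ColD (n + 1)}"
    if "j \<in> {1..n + 1}"
    unfolding prob_pair_Times[symmetric]
    by (rule transport) (simp only: append_in_S_sub(1)[OF n support that] mem_Times_iff fst_conv snd_conv mem_Collect_eq)
  let ?B = "\<lambda>i. S_sub i (n + 1) \<times> {v. v ! (n + 1 - i) = ColD (n + 1)}"
  have "measure_pmf.prob (complete_experiment (Suc n) m k) (S_sub (n + 2) (n + 2)) =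
      measure_pmf.prob (pair_pmf E R) (\<Union>i\<in>{1..n + 1}. ?B i)"
    by (rule transport)
      (simp only: append_in_S_sub(2)[OF n support] UN_iff mem_Times_iff fst_conv snd_conv mem_Collect_eq)
  also have "\<dots> = (\<Sum>i = 1..n + 1. measure_pmf.prob (pair_pmf E R) (?B i))"
    by (rule measure_pmf.finite_measure_finite_Union)
      (auto simp: disjoint_family_on_def dest: S_sub_disjoint)
  finally show "measure_pmf.prob (complete_experiment (Suc n) m k) (S_sub (n + 2) (n + 2)) =
      (\<Sum>i = 1..n + 1. measure_pmf.prob E (S_sub i (n + 1)) *
                        measure_pmf.prob R {v. v ! (n + 1 - i) = ColD (n + 1)})"
    by (simp only: prob_pair_Times)
qed

text \<open>The identity is proved with signs, without absolute values, so that it can enter the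
  partial fraction sum.\<close>

lemma prob_S_sub:
  fixes m k :: "nat \<Rightarrow> int"
  assumes "n \<ge> 1" "interlacing n m k" "j \<in> {1..n + 1}"
  defines "x \<equiv> \<lambda>i. real_of_int (m i - int i)" and "y \<equiv> \<lambda>i. real_of_int (k i - int i - 1)"
  shows "measure_pmf.prob (complete_experiment n m k) (S_sub j (n + 1)) = lagrange_weight x y n j"
  using assms(1-3)
proof (induction n arbitrary: j rule: dec_induct)
  case base
  interpret interlacing 1 m k by fact
  have E: "complete_experiment 1 m k = map_pmf (\<lambda>c. [c]) (pmf_of_multiset (urn m k 1))"
    by (simp add: complete_experiment_def places_def urn_union_def map_pmf_def bind_return_pmf)
  have ne: "urn m k 1 \<noteq> {#}"
    using urn_union_nonempty[of 1 1] by (simp add: urn_union_def)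
  have sing: "(\<lambda>c. [c]) -` {[a]} = {a}" for a :: color by auto
  have C: "real (count (urn m k 1) (ColC 1)) = x 1 - y 1"
    and D: "real (count (urn m k 1) (ColD 1)) = y 1 - x 2"
    using interlacing[of 1] by (simp_all add: urn_def x_def y_def numeral_2_eq_2)
  have size: "real (size (urn m k 1)) = x 1 - x 2"
    using size_urn[of 1] by (simp add: x_def numeral_2_eq_2)
  have A: "{Suc 0..Suc (Suc 0)} - {Suc 0} = {2}" "{Suc 0..Suc (Suc 0)} - {2} = {Suc 0}" by auto
  consider "j = 1" | "j = 2" using base(2) by force
  then show ?case
  proof cases
    case 1
    then show ?thesis
      unfolding E using ne C size
      by (simp add: S_sub.simps sing lagrange_weight_def A prob_pmf_of_multiset_singleton)
  next
    case 2
    then show ?thesis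
      \<comment> \<open>Here the weight is \<open>(x 2 - y 1) / (x 2 - x 1)\<close>, the ratio of
        count to size with both signs flipped.\<close>
      unfolding E using ne D size minus_divide_divide[of "y 1 - x 2" "x 1 - x 2"]
      by (simp add: S_sub.simps sing lagrange_weight_def A prob_pmf_of_multiset_singleton)
  qed
next
  case (step n)
  interpret interlacing "Suc n" m k by fact
  have prev: "interlacing n m k"
    using interlacing by unfold_locales auto
  note IH = step.IH[OF prev]
  note prob_Suc = prob_complete_experiment_Suc[OF step.hyps(1) \<open>interlacing (Suc n) m k\<close>]
  show ?case
  proof (cases "j = n + 2")
    case False
    then have j: "j \<in> {1..n + 1}"
      using step.prems(2) by auto
    have "measure_pmf.prob (row_draws m k (Suc n)) {v. v ! (n + 1 - j) \<noteq> ColD (n + 1)} =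
        (x j - y (Suc n)) / (x j - x (n + 2))"
      using prob_row_not_ColD[of j] j by (simp add: x_def y_def)
    then show ?thesis
      using prob_Suc(1)[OF j] unfolding IH[OF j] by (simp add: lagrange_weight_Suc[OF j] del: of_int_diff)
  next
    case True
    let ?u = "x (n + 2)" and ?b = "y (n + 1)"
    have "measure_pmf.prob (complete_experiment (Suc n) m k) (S_sub (n + 2) (n + 2)) =
        (\<Sum>i = 1..n + 1. lagrange_weight x y n i * ((?b - ?u) / (x i - ?u)))"
      unfolding prob_Suc(2) using prob_row_ColD
      by (intro sum.cong refl arg_cong2[where f = "(*)"] IH) (simp_all add: x_def y_def)
    \<comment> \<open>Flipping both signs produces the denominators \<open>?u - x i\<close> of
      \<open>partial_fractions\<close> at the point \<open>?u\<close>.\<close>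
    also have "\<dots> = (\<Sum>i = 1..n + 1. (?u - ?b) * (lagrange_weight x y n i / (?u - x i)))"
    proof (intro sum.cong refl)
      fix i
      have "(?b - ?u) / (x i - ?u) = (?u - ?b) / (?u - x i)"
        using minus_divide_divide[of "?u - ?b" "?u - x i"] by simp
      then show "lagrange_weight x y n i * ((?b - ?u) / (x i - ?u)) =
          (?u - ?b) * (lagrange_weight x y n i / (?u - x i))"
        by (simp only: times_divide_eq_right mult.commute)
    qed
    also have "\<dots> = (?u - ?b) * ((\<Prod>i = 1..n. ?u - y i) / (\<Prod>i = 1..n + 1. ?u - x i))"
      unfolding sum_distrib_left[symmetric]
    proof (subst partial_fractions)
      show "inj_on x {1..n + 1}"
        using interlacing.inj_on_x[OF prev] by (simp add: x_def)
      show "?u \<noteq> x i" if "i \<in> {1..n + 1}" for i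
        using x_strict_antimono[of i "n + 2"] that by (auto simp: x_def)
    qed simp
    also have "\<dots> = lagrange_weight x y (Suc n) (n + 2)"
      unfolding lagrange_weight_last by (simp only: Suc_eq_plus1)
    finally show ?thesis
      using True by simp
  qed
qed

theorem theorem5p3:
  fixes n j :: nat and m k :: "nat \<Rightarrow> int"
  assumes "n \<ge> 1"
    and "\<forall>i\<in>{1..n}. m i \<ge> k i \<and> k i \<ge> m (i + 1)"
    and "j \<in> {1..n + 1}"
  shows "measure_pmf.prob (complete_experiment n m k) (S_sub j (n + 1)) =
    \<bar>real_of_int (\<Prod>i = 1..n. k i - m j - int i + int j - 1) /
     real_of_int (\<Prod>i\<in>{1..n + 1} - {j}. m i - m j - int i + int j)\<bar>"
proof -
  let ?P = "measure_pmf.prob (complete_experiment n m k) (S_sub j (n + 1))"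
  have "interlacing n m k"
    using assms(2) by unfold_locales auto
  with assms(1) have "?P = lagrange_weight (\<lambda>i. real_of_int (m i - int i)) (\<lambda>i. real_of_int (k i - int i - 1)) n j"
    using assms(3) by (rule prob_S_sub)
  then have "?P = \<bar>lagrange_weight (\<lambda>i. real_of_int (m i - int i)) (\<lambda>i. real_of_int (k i - int i - 1)) n j\<bar>"
    by (metis abs_of_nonneg measure_nonneg)
  also have "\<dots> = \<bar>real_of_int (\<Prod>i = 1..n. k i - m j - int i + int j - 1) /
     real_of_int (\<Prod>i\<in>{1..n + 1} - {j}. m i - m j - int i + int j)\<bar>"
    \<comment> \<open>Each factor \<open>x j - y i\<close> or \<open>x j - x i\<close> is the
      negative of the corresponding factor in the claim, so the absolute values agree factor by
      factor.\<close>
    unfolding lagrange_weight_def abs_divide abs_prod of_int_prod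
    by (intro arg_cong2[where f = "(/)"] prod.cong refl) auto
  finally show ?thesis .
qed

end
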